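(* Let $p\geq 3$ be prime, let $f'>1$ be an odd integer divisible by $p$, and let $n\geq 1$. Set $f=p^nf'$ and $$H_{p^n}=\{1+kf';\ 0\leq k\leq p^n-1\}=\ker\left((\mathbb{Z}/f\mathbb{Z})^*\twoheadrightarrow(\mathbb{Z}/f'\mathbb{Z})^*\right),$$ a subgroup of order $p^n$ of $(\mathbb{Z}/f\mathbb{Z})^*$. Then $T(H_{p^n},f):=\sum_{k=0}^{p^n-1}(1+kf')=p^n+\frac{p^n-1}{2}f$, hence $\gcd(f,T(H_{p^n},f))=p^n$, and $$S(H_{p^n},f):=\sum_{h\in H_{p^n}}s(h,f)=\sum_{k=0}^{p^n-1}s(1+kf',f)=\frac{p^{n+1}+p^n-1}{12p^{n+1}}f-\frac{p^n}{4}+\frac{p^n}{6f}.$$ Consequently, the rational number $2\gcd(3,f)\frac{f}{p^n}S(H_{p^n},f)$ is an integer not divisible by $p$, and it is odd if and only if $f\equiv 3\pmod 4$.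
   Context: For $d>1$ and $\gcd(c,d)=1$, the Dedekind sum is $s(c,d):=\frac{1}{4d}\sum_{a=1}^{d-1}\cot\left(\frac{\pi a}{d}\right)\cot\left(\frac{\pi a c}{d}\right)$; it depends only on $c$ modulo $d$. *)

theory Defs
  imports Complex_Main "HOL-Number_Theory.Residues"
begin

text \<open>The Dedekind sum, meant for \<open>d > 1\<close> and \<open>c\<close> coprime to \<open>d\<close>.\<close>

definition dedekind_sum :: "int \<Rightarrow> nat \<Rightarrow> real" where
  "dedekind_sum c d =
     1 / (4 * real d) *
       (\<Sum>a = 1..d - 1. cot (pi * real a / real d) * cot (pi * real a * of_int c / real d))"

lemma cot_add_int_pi: "cot (x + pi * of_int j) = cot (x :: real)"
proof -
  have "cos (pi * of_int j) \<noteq> (0 :: real)"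
    by simp
  then show ?thesis
    by (simp add: cot_def sin_add cos_add del: cos_npi_int)
qed

lemma dedekind_sum_cong:
  assumes "[c = c'] (mod int d)"
  shows "dedekind_sum c d = dedekind_sum c' d"
proof (cases "d = 0")
  case False
  obtain j where j: "c = c' + int d * j"
    using assms by (metis cong_iff_lin cong_sym)
  have "cot (pi * real a * of_int c / real d) = cot (pi * real a * of_int c' / real d)" for a
  proof -
    have "pi * real a * of_int c / real d
        = pi * real a * of_int c' / real d + pi * of_int (int a * j)"
      using False by (simp add: j field_simps)
    then show ?thesis
      by (simp only: cot_add_int_pi)
  qed
  then show ?thesis
    by (simp add: dedekind_sum_def)
qed (simp add: dedekind_sum_def)

text \<open>
  \<open>(\<int>/m\<int>)\<^sup>*\<close>; residue classes are represented by their least nonnegative residues,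
  as in \<open>residue_ring\<close>.
\<close>

definition mult_group_mod :: "nat \<Rightarrow> int monoid" where
  "mult_group_mod m = units_of (residue_ring (int m))"

text \<open>
  \<open>H_ker (p ^ n) f'\<close> is \<open>{1 + k f' | 0 \<le> k \<le> p^n - 1}\<close>. Its elements lie below \<open>p^n f'\<close>,
  so they are already least residues modulo \<open>p^n f'\<close>.
\<close>

definition H_ker :: "nat \<Rightarrow> nat \<Rightarrow> int set" where
  "H_ker q f' = {1 + int k * int f' | k. 0 \<le> k \<and> k \<le> q - 1}"

definition T_sum :: "nat \<Rightarrow> nat \<Rightarrow> int" where
  "T_sum q f' = (\<Sum>k = 0..q - 1. 1 + int k * int f')"

definition S_sum :: "int set \<Rightarrow> nat \<Rightarrow> real" where
  "S_sum H f = (\<Sum>h\<in>H. dedekind_sum h f)"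

end

theory Submission
  imports Defs
begin

text \<open>
  Write \<open>q = p ^ n\<close> and interchange the sums over \<open>k\<close> and \<open>a\<close> in the sum of the \<open>s(1 + k f', f)\<close>.
  For \<open>a\<close> prime to \<open>p\<close> the inner sum is the sum of \<open>cot (x + \<pi> k a / q)\<close> over \<open>k\<close> modulo \<open>q\<close>,
  \<open>x = \<pi> a / f\<close>, which equals \<open>q cot (\<pi> a / f')\<close>; summing over the \<open>a\<close> in a class \<open>c\<close> modulo \<open>f'\<close>
  produces a second such sum, hence \<open>q\<^sup>2 cot\<^sup>2 (\<pi> c / f')\<close>.  The \<open>a\<close> divisible by \<open>p\<close> reproduce \<open>p\<close>
  times the same double sum for \<open>n - 1\<close>.  The recursion is solved by the evaluation
  \<open>\<Sum>c<m. cot\<^sup>2 (\<pi> c / m) = (m - 1) (m - 2) / 3\<close>, which is Parseval's identity on \<open>\<int>/m\<int>\<close> for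
  \<open>j \<mapsto> j\<close>.
\<close>

subsection \<open>Cotangent sums over roots of unity\<close>

lemma cis_two_pi_eq_1_iff: "cis (2 * pi * x) = 1 \<longleftrightarrow> x \<in> \<int>"
proof
  assume "cis (2 * pi * x) = 1"
  then have "cos (2 * pi * x) = 1"
    by (metis cis.simps(1) one_complex.simps(1))
  then obtain k :: int where "2 * pi * x = real_of_int k * 2 * pi"
    using cos_one_2pi_int by blast
  then have "x = of_int k"
    by simp
  then show "x \<in> \<int>"
    by simp
qed simp

lemma of_int_divide_of_nat_in_Ints_iff:
  assumes "N > 0"
  shows "real_of_int j / real N \<in> \<int> \<longleftrightarrow> int N dvd j"
proof -
  have "real_of_int j / real N \<in> \<int> \<longleftrightarrow> (\<exists>k. real_of_int j / real N = of_int k)"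
    by (auto simp: Ints_def)
  also have "\<dots> \<longleftrightarrow> (\<exists>k. real_of_int j = of_int (int N * k))"
    using assms by (simp add: field_simps)
  also have "\<dots> \<longleftrightarrow> int N dvd j"
    by (simp only: of_int_eq_iff dvd_def)
  finally show ?thesis .
qed

text \<open>Orthogonality of the additive characters of Z/N: a geometric sum whose ratio
  \<open>w\<close> satisfies \<open>w ^ N = 1\<close>, and \<open>w = 1\<close> exactly when N
  divides j.\<close>

lemma sum_cis_multiples:
  assumes "N > 0"
  shows "(\<Sum>k<N. cis (2 * pi * (real k * of_int j / real N))) = (if int N dvd j then of_nat N else 0)"
proof -
  define w where "w = cis (2 * pi * (of_int j / real N))"
  have "(\<Sum>k<N. cis (2 * pi * (real k * of_int j / real N))) = (\<Sum>k<N. w ^ k)"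
    unfolding w_def DeMoivre by (intro sum.cong) (auto simp: algebra_simps)
  moreover have "w ^ N = 1"
    using assms by (simp add: w_def DeMoivre cis_multiple_2pi)
  moreover have "w = 1 \<longleftrightarrow> int N dvd j"
    unfolding w_def cis_two_pi_eq_1_iff of_int_divide_of_nat_in_Ints_iff[OF assms] ..
  moreover have "w = 1 \<Longrightarrow> (\<Sum>k<N. w ^ k) = of_nat N"
    by simp
  moreover have "w \<noteq> 1 \<Longrightarrow> w ^ N = 1 \<Longrightarrow> (\<Sum>k<N. w ^ k) = 0"
    by (simp add: sum_gp_strict)
  ultimately show ?thesis
    by auto
qed

text \<open>Each N-th root of unity w gives (1 - z^N) / (1 - z w) = sum of z^j w^j over j < N.
  Summing over the roots kills every power except j = 0; coprimality of a and N ensures that N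
  divides j a only for that j.\<close>

lemma sum_inverse_one_minus_roots:
  assumes "N > 0" "coprime a N" "z ^ N \<noteq> 1"
  shows "(\<Sum>k<N. 1 / (1 - z * cis (2 * pi * (real k * real a / real N)))) = of_nat N / (1 - z ^ N)"
proof -
  define w where "w k = cis (2 * pi * (real k * real a / real N))" for k
  have wN: "w k ^ N = 1" for k
  proof -
    have "w k ^ N = cis (2 * pi * of_nat (k * a))"
      using assms by (simp add: w_def DeMoivre algebra_simps)
    also have "\<dots> = 1"
      by (simp only: cis_two_pi_eq_1_iff Ints_of_nat)
    finally show ?thesis .
  qed
  have "(1 - z ^ N) * (1 / (1 - z * w k)) = (\<Sum>j<N. z ^ j * w k ^ j)" for k
  proof -
    have "(z * w k) ^ N = z ^ N"
      by (simp add: power_mult_distrib wN)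
    moreover from this have "z * w k \<noteq> 1"
      using assms(3) by force
    ultimately show ?thesis
      using one_diff_power_eq[of "z * w k" N]
      by (simp add: power_mult_distrib[symmetric])
  qed
  then have "(1 - z ^ N) * (\<Sum>k<N. 1 / (1 - z * w k)) = (\<Sum>k<N. \<Sum>j<N. z ^ j * w k ^ j)"
    by (simp add: sum_distrib_left)
  also have "\<dots> = (\<Sum>j<N. z ^ j * (\<Sum>k<N. w k ^ j))"
    by (subst sum.swap) (simp add: sum_distrib_left)
  also have "\<dots> = (\<Sum>j<N. if j = 0 then of_nat N else 0)"
  proof (intro sum.cong refl)
    fix j assume j: "j \<in> {..<N}"
    have "(\<Sum>k<N. w k ^ j) = (\<Sum>k<N. cis (2 * pi * (real k * of_int (int (j * a)) / real N)))"
      unfolding w_def DeMoivre by (intro sum.cong) (auto simp: algebra_simps)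
    also have "\<dots> = (if N dvd j * a then of_nat N else 0)"
      using sum_cis_multiples[OF assms(1), of "int (j * a)"] by (simp only: int_dvd_int_iff)
    also have "N dvd j * a \<longleftrightarrow> j = 0"
      using assms j by (auto simp: coprime_dvd_mult_left_iff coprime_commute dest: dvd_imp_le)
    finally show "z ^ j * (\<Sum>k<N. w k ^ j) = (if j = 0 then of_nat N else 0)"
      by simp
  qed
  also have "\<dots> = of_nat N"
    using assms(1) by simp
  finally show ?thesis
    using assms(3) by (simp add: w_def field_simps)
qed

lemma cis_double_eq_1_iff: "cis (2 * x) = 1 \<longleftrightarrow> sin x = 0"
proof -
  have "cis (2 * x) = 1 \<longleftrightarrow> x / pi \<in> \<int>"
    using cis_two_pi_eq_1_iff[of "x / pi"] by simp
  also have "\<dots> \<longleftrightarrow> sin x = 0"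
    using sin_times_pi_eq_0[of "x / pi"] by simp
  finally show ?thesis .
qed

text \<open>From cot x = i (e + 1) / (e - 1) with e = \<open>cis (2 * x)\<close>. The form with a
  single pole term turns a sum of translated cotangents into the sum over roots of unity treated
  above.\<close>

lemma of_real_cot_conv_cis:
  assumes "sin x \<noteq> 0"
  shows "complex_of_real (cot x) = \<i> - 2 * \<i> / (1 - cis (2 * x))"
proof -
  have ne: "1 - cis (2 * x) \<noteq> 0"
    using assms cis_double_eq_1_iff[of x] by auto
  have cs: "cos x * sin (2 * x) = sin x * (1 + cos (2 * x))"
    by (simp add: cos_double_cos sin_double power2_eq_square)
  have "complex_of_real (cos x) * (1 - cis (2 * x))
      = (\<i> * (1 - cis (2 * x)) - 2 * \<i>) * complex_of_real (sin x)"
  proof (rule complex_eqI)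
    show "Re (complex_of_real (cos x) * (1 - cis (2 * x)))
        = Re ((\<i> * (1 - cis (2 * x)) - 2 * \<i>) * complex_of_real (sin x))"
      by (simp add: cos_double_sin sin_double power2_eq_square)
    show "Im (complex_of_real (cos x) * (1 - cis (2 * x)))
        = Im ((\<i> * (1 - cis (2 * x)) - 2 * \<i>) * complex_of_real (sin x))"
      using cs by (simp add: algebra_simps)
  qed
  then have "complex_of_real (cos x) / complex_of_real (sin x)
      = (\<i> * (1 - cis (2 * x)) - 2 * \<i>) / (1 - cis (2 * x))"
    using ne assms by (simp add: frac_eq_eq)
  then show ?thesis
    using ne by (simp add: cot_def diff_divide_distrib)
qed

text \<open>The multiplication formula for the cotangent; a step a prime to N merely permutes the N
  translates modulo pi.\<close>

lemma sum_cot_translates: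
  assumes "N > 0" "coprime a N" "sin (real N * x) \<noteq> 0"
  shows "(\<Sum>k<N. cot (x + pi * (real k * real a / real N))) = real N * cot (real N * x)"
proof -
  define z where "z = cis (2 * x)"
  have zN: "z ^ N = cis (2 * (real N * x))"
    by (simp add: z_def DeMoivre algebra_simps)
  have "complex_of_real (cot (x + pi * (real k * real a / real N)))
      = \<i> - 2 * \<i> * (1 / (1 - z * cis (2 * pi * (real k * real a / real N))))" for k
  proof -
    \<comment> \<open>No translate is a pole: multiplying a zero of this sine by N would make N x a
      multiple of pi.\<close>
    have "sin (x + pi * (real k * real a / real N)) \<noteq> 0"
    proof
      assume "sin (x + pi * (real k * real a / real N)) = 0"
      then obtain i :: int where "x + pi * (real k * real a / real N) = of_int i * pi"
        using sin_zero_iff_int2 by blast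
      then have "real N * x = of_int (int N * i - int k * int a) * pi"
        using assms(1) by (simp add: field_simps)
      then show False
        using assms(3) sin_zero_iff_int2 by blast
    qed
    then show ?thesis
      by (simp add: of_real_cot_conv_cis z_def cis_mult algebra_simps)
  qed
  then have "complex_of_real (\<Sum>k<N. cot (x + pi * (real k * real a / real N)))
      = of_nat N * \<i> - 2 * \<i> * (\<Sum>k<N. 1 / (1 - z * cis (2 * pi * (real k * real a / real N))))"
    by (simp add: sum_subtractf sum_distrib_left)
  also have "\<dots> = of_nat N * \<i> - 2 * \<i> * (of_nat N / (1 - z ^ N))"
    using assms zN cis_double_eq_1_iff[of "real N * x"] by (subst sum_inverse_one_minus_roots) auto
  also have "\<dots> = complex_of_real (real N * cot (real N * x))"
    unfolding of_real_mult of_real_cot_conv_cis[OF assms(3)] zN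
    by (simp add: right_diff_distrib)
  finally show ?thesis
    by (simp only: of_real_eq_iff)
qed

section \<open>Parseval's identity and the sum of squared cotangents\<close>

lemma sin_pi_divide_eq_0_iff:
  assumes "m > 0"
  shows "sin (pi * real c / real m) = 0 \<longleftrightarrow> m dvd c"
  using sin_times_pi_eq_0[of "real c / real m"] of_int_divide_of_nat_in_Ints_iff[OF assms, of "int c"]
  by (simp add: mult.commute)

text \<open>Summation by parts. For an m-th root of unity w other than 1 the right side is just m,
  so the Fourier coefficient of the index function is m / (w - 1).\<close>

lemma sum_index_times_power:
  fixes w :: "'a :: comm_ring_1"
  shows "(w - 1) * (\<Sum>j<m. of_nat j * w ^ j) = of_nat m * w ^ m - w * (\<Sum>j<m. w ^ j)"
  by (induction m) (auto simp: algebra_simps)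

lemma sum_index: "(\<Sum>j<m. real j) = real m * (real m - 1) / 2"
  by (induction m) (auto simp: field_simps)

lemma sum_index_squared: "(\<Sum>j<m. (real j)\<^sup>2) = real m * (real m - 1) * (2 * real m - 1) / 6"
  by (induction m) (auto simp: field_simps power2_eq_square)

text \<open>Parseval on Z/m: each squared norm is expanded as a double sum over j and k, and summing
  over c by orthogonality leaves the diagonal.\<close>

lemma sum_norm_transform_of_index:
  assumes "m > 0"
  shows "(\<Sum>c<m. (norm (\<Sum>j<m. of_nat j * cis (2 * pi * (real c / real m)) ^ j))\<^sup>2)
    = real m * (\<Sum>j<m. (real j)\<^sup>2)"
proof -
  have "complex_of_real (\<Sum>c<m. (norm (\<Sum>j<m. of_nat j * cis (2 * pi * (real c / real m)) ^ j))\<^sup>2)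
      = (\<Sum>c<m. \<Sum>j<m. \<Sum>k<m. of_nat j * of_nat k *
           cis (2 * pi * (real c * of_int (int j - int k) / real m)))"
    unfolding of_real_sum complex_norm_square
    by (intro sum.cong refl)
       (simp add: sum_product DeMoivre cis_cnj cis_mult algebra_simps diff_divide_distrib)
  also have "\<dots> = (\<Sum>j<m. \<Sum>k<m. of_nat j * of_nat k *
         (\<Sum>c<m. cis (2 * pi * (real c * of_int (int j - int k) / real m))))"
    unfolding sum_distrib_left
    by (subst sum.swap, rule sum.cong[OF refl], rule sum.swap)
  also have "\<dots> = (\<Sum>j<m. \<Sum>k<m. if k = j then of_nat m * (of_nat j)\<^sup>2 else 0)"
  proof (intro sum.cong refl)
    fix j k assume "j \<in> {..<m}" "k \<in> {..<m}"
    then have "int m dvd int j - int k \<longleftrightarrow> k = j"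
      by (auto simp: cong_int_iff cong_def simp flip: cong_iff_dvd_diff)
    then show "of_nat j * of_nat k * (\<Sum>c<m. cis (2 * pi * (real c * of_int (int j - int k) / real m)))
        = (if k = j then of_nat m * (of_nat j)\<^sup>2 else (0 :: complex))"
      by (subst sum_cis_multiples[OF assms]) (auto simp: power2_eq_square)
  qed
  also have "\<dots> = complex_of_real (real m * (\<Sum>j<m. (real j)\<^sup>2))"
    by (simp add: sum_distrib_left)
  finally show ?thesis
    by (simp only: of_real_eq_iff)
qed

text \<open>For c nonzero modulo m the squared Fourier coefficient is m^2 / (4 sin^2) = m^2 (1 +
  cot^2) / 4, so Parseval becomes a linear equation for the cotangent sum once the term c = 0 is
  computed separately.\<close>

lemma sum_cot_squared:
  assumes "m > 0"
  shows "(\<Sum>c<m. (cot (pi * real c / real m))\<^sup>2) = (real m - 1) * (real m - 2) / 3"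
proof -
  define N where "N c = (norm (\<Sum>j<m. of_nat j * cis (2 * pi * (real c / real m)) ^ j))\<^sup>2" for c
  have N: "N c = (real m)\<^sup>2 / 4 * (1 + (cot (pi * real c / real m))\<^sup>2)" if "c \<in> {1..<m}" for c
  proof -
    define x where "x = pi * real c / real m"
    define w where "w = cis (2 * x)"
    have sin: "sin x \<noteq> 0"
      using that assms by (auto simp: x_def sin_pi_divide_eq_0_iff dest: dvd_imp_le)
    then have "w \<noteq> 1"
      by (simp add: w_def cis_double_eq_1_iff)
    have wm: "w ^ m = 1"
    proof -
      have "w ^ m = cis (2 * pi * real c)"
        unfolding w_def x_def DeMoivre using assms by (intro arg_cong[of _ _ cis]) simp
      then show ?thesis
        by (simp only: cis_two_pi_eq_1_iff Ints_of_nat)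
    qed
    have norm_w: "(norm (w - 1))\<^sup>2 = 4 * (sin x)\<^sup>2"
    proof -
      have "(norm (w - 1))\<^sup>2 = (2 * (sin x)\<^sup>2)\<^sup>2 + (2 * sin x * cos x)\<^sup>2"
        by (simp add: w_def cmod_power2 cos_double_sin sin_double)
      moreover have "(2 * a\<^sup>2)\<^sup>2 + (2 * a * b)\<^sup>2 = 4 * a\<^sup>2 * (a\<^sup>2 + b\<^sup>2)" for a b :: real
        by (simp add: power2_eq_square algebra_simps)
      ultimately show ?thesis
        by simp
    qed
    have "(w - 1) * (\<Sum>j<m. of_nat j * w ^ j) = of_nat m"
      using wm \<open>w \<noteq> 1\<close> by (simp add: sum_index_times_power sum_gp_strict)
    then have "(norm (w - 1))\<^sup>2 * (norm (\<Sum>j<m. of_nat j * w ^ j))\<^sup>2 = (real m)\<^sup>2"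
      by (metis norm_mult norm_of_nat power_mult_distrib)
    moreover have "cis (2 * pi * (real c / real m)) = w"
      by (simp add: w_def x_def mult.assoc)
    ultimately have N_eq: "4 * (sin x)\<^sup>2 * N c = (real m)\<^sup>2"
      by (simp add: norm_w N_def)
    have cot_eq: "1 + (cot x)\<^sup>2 = 1 / (sin x)\<^sup>2"
      using sin by (simp add: cot_def power_divide cos_squared_eq field_simps)
    show ?thesis
      unfolding x_def[symmetric] cot_eq using sin N_eq by (simp add: field_simps)
  qed
  have N0: "N 0 = (real m * (real m - 1) / 2)\<^sup>2"
  proof -
    have "(\<Sum>j<m. complex_of_nat j) = complex_of_real (real m * (real m - 1) / 2)"
      by (simp flip: sum_index)
    then have "N 0 = \<bar>real m * (real m - 1) / 2\<bar>\<^sup>2"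
      unfolding N_def by (simp del: of_real_mult of_real_divide)
    then show ?thesis
      by (simp only: power2_abs)
  qed
  have split: "(\<Sum>c<m. g c) = g 0 + (\<Sum>c\<in>{1..<m}. g c)" for g :: "nat \<Rightarrow> real"
    using assms by (simp add: lessThan_atLeast0 sum.atLeast_Suc_lessThan)
  have "real m * (real m * (real m - 1) * (2 * real m - 1) / 6) = (\<Sum>c<m. N c)"
    using sum_norm_transform_of_index[OF assms] by (simp add: N_def sum_index_squared)
  also have "\<dots> = N 0 + (\<Sum>c\<in>{1..<m}. (real m)\<^sup>2 / 4 * (1 + (cot (pi * real c / real m))\<^sup>2))"
    by (simp add: split[of N] N)
  also have "\<dots> = (real m * (real m - 1) / 2)\<^sup>2
      + (real m)\<^sup>2 / 4 * ((real m - 1) + (\<Sum>c\<in>{1..<m}. (cot (pi * real c / real m))\<^sup>2))"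
    using assms by (simp only: N0 sum_distrib_left[symmetric] sum.distrib) (simp add: of_nat_diff)
  \<comment> \<open>The index 0 may be included because \<open>cot 0 = 0\<close>.\<close>
  also have "(\<Sum>c\<in>{1..<m}. (cot (pi * real c / real m))\<^sup>2) = (\<Sum>c<m. (cot (pi * real c / real m))\<^sup>2)"
    by (simp add: split)
  finally have "(real m)\<^sup>2 * (3 * (\<Sum>c<m. (cot (pi * real c / real m))\<^sup>2))
      = (real m)\<^sup>2 * ((real m - 1) * (real m - 2))"
    by (simp add: field_simps power2_eq_square)
  then show ?thesis
    using assms by simp
qed

subsection \<open>The sum of the Dedekind sums\<close>

lemma sum_lessThan_mult:
  fixes g :: "nat \<Rightarrow> 'a :: comm_monoid_add"
  shows "(\<Sum>a<q * M. g a) = (\<Sum>m<q. \<Sum>c<M. g (c + m * M))"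
proof -
  have "sum g {m * M..<m * M + M} = (\<Sum>c<M. g (c + m * M))" for m
    using sum.shift_bounds_nat_ivl[of g 0 "m * M" M] by (simp add: lessThan_atLeast0 add.commute)
  then show ?thesis
    by (simp flip: sum.nat_group)
qed

lemma sum_lessThan_mult_split_dvd:
  fixes g :: "nat \<Rightarrow> real"
  assumes "p > 0"
  shows "(\<Sum>a<p * M. g a) = (\<Sum>b<M. g (p * b)) + (\<Sum>a<p * M. if p dvd a then 0 else g a)"
proof -
  have "(\<Sum>b<M. g (p * b)) = (\<Sum>a | a < p * M \<and> p dvd a. g a)"
    by (rule sum.reindex_bij_witness[of _ "\<lambda>a. a div p" "\<lambda>b. p * b"]) (use assms in auto)
  also have "\<dots> = (\<Sum>a<p * M. if p dvd a then g a else 0)"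
    by (subst sum.inter_filter[symmetric]) auto
  finally show ?thesis
    by (simp flip: sum.distrib) (intro sum.cong, auto)
qed

text \<open>This is \<open>4 q M\<close> times the sum of the Dedekind sums; the term \<open>a = 0\<close> vanishes because \<open>cot 0 = 0\<close>.\<close>

definition cot_sum :: "nat \<Rightarrow> nat \<Rightarrow> real" where
  "cot_sum q M = (\<Sum>a<q * M. cot (pi * real a / real (q * M)) *
     (\<Sum>k<q. cot (pi * real a * (1 + real k * real M) / real (q * M))))"

text \<open>The argument is x + pi k a / q with x = pi c / (q M). It serves twice: with a = c for
  the inner sum over k, and with a = 1 for the sum over a residue class modulo M.\<close>

lemma sum_cot_progression:
  assumes "q > 0" "M > 0" "coprime a q" "\<not> M dvd c"
  shows "(\<Sum>k<q. cot (pi * (real c + real k * real a * real M) / real (q * M)))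
    = real q * cot (pi * real c / real M)"
proof -
  define x where "x = pi * real c / real (q * M)"
  have qx: "real q * x = pi * real c / real M"
    using assms by (simp add: x_def)
  have "(\<Sum>k<q. cot (pi * (real c + real k * real a * real M) / real (q * M)))
      = (\<Sum>k<q. cot (x + pi * (real k * real a / real q)))"
    using assms by (intro sum.cong refl arg_cong[of _ _ cot]) (simp add: x_def field_simps)
  also have "\<dots> = real q * cot (real q * x)"
    using assms by (intro sum_cot_translates) (auto simp: qx sin_pi_divide_eq_0_iff)
  finally show ?thesis
    by (simp only: qx)
qed

lemma cot_sum_prime_power_Suc:
  assumes "prime p" "M > 0" "p dvd M"
  shows "cot_sum (p ^ Suc n) M = real p * cot_sum (p ^ n) M
    + (real (p ^ Suc n))\<^sup>2 * (\<Sum>c<M. if p dvd c then 0 else (cot (pi * real c / real M))\<^sup>2)"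
proof -
  define q Q where "q = p ^ n" and "Q = p ^ Suc n"
  define g where "g a = cot (pi * real a / real (Q * M)) *
     (\<Sum>k<Q. cot (pi * real a * (1 + real k * real M) / real (Q * M)))" for a
  have p: "p > 0" and q: "q > 0" and Q: "Q > 0" and Qpq: "Q = p * q"
    using assms prime_gt_0_nat[of p] by (auto simp: q_def Q_def)
  have dvd_part: "g (p * b) = real p * (cot (pi * real b / real (q * M)) *
     (\<Sum>k<q. cot (pi * real b * (1 + real k * real M) / real (q * M))))" for b
  proof -
    define h where "h k = cot (pi * real b * (1 + real k * real M) / real (q * M))" for k
    \<comment> \<open>Raising k by m q moves the argument by pi b m, so \<open>h\<close> has period
      q and the sum over p q indices is p copies of the sum over q.\<close>
    have shift: "h (c + m * q) = h c" for c m
    proof -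
      have "pi * real b * (1 + real (c + m * q) * real M) / real (q * M)
          = pi * real b * (1 + real c * real M) / real (q * M) + pi * of_int (int (b * m))"
        using q assms(2) by (simp add: field_simps)
      then show ?thesis
        unfolding h_def by (simp only: cot_add_int_pi)
    qed
    have "(\<Sum>k<Q. cot (pi * real (p * b) * (1 + real k * real M) / real (Q * M))) = (\<Sum>k<p * q. h k)"
      unfolding Qpq h_def using p
      by (intro sum.cong refl arg_cong[of _ _ cot]) simp
    also have "\<dots> = real p * (\<Sum>k<q. h k)"
      by (simp add: sum_lessThan_mult shift)
    finally show ?thesis
      using p by (simp add: g_def h_def Qpq)
  qed
  have not_dvd_part: "g a = cot (pi * real a / real (Q * M)) * (real Q * cot (pi * real a / real M))"
    if "\<not> p dvd a" for a
  proof -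
    have "coprime a Q"
      using prime_imp_coprime[OF assms(1) that] by (auto simp: Q_def coprime_commute)
    moreover have "\<not> M dvd a"
      using that assms(3) dvd_trans by blast
    ultimately have "(\<Sum>k<Q. cot (pi * (real a + real k * real a * real M) / real (Q * M)))
        = real Q * cot (pi * real a / real M)"
      using Q assms(2) by (intro sum_cot_progression) auto
    then show ?thesis
      unfolding g_def by (simp add: algebra_simps)
  qed
  have cot_shift: "cot (pi * real (c + m * M) / real M) = cot (pi * real c / real M)" for c m
  proof -
    have "pi * real (c + m * M) / real M = pi * real c / real M + pi * of_int (int m)"
      using assms(2) by (simp add: field_simps)
    then show ?thesis
      by (simp only: cot_add_int_pi)
  qed
  have "cot_sum Q M = (\<Sum>a<p * (q * M). g a)"
    by (simp add: cot_sum_def g_def Qpq mult.assoc)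
  also have "\<dots> = (\<Sum>b<q * M. g (p * b)) + (\<Sum>a<p * (q * M). if p dvd a then 0 else g a)"
    using p by (rule sum_lessThan_mult_split_dvd)
  also have "(\<Sum>b<q * M. g (p * b)) = real p * cot_sum q M"
    by (simp only: dvd_part cot_sum_def sum_distrib_left)
  also have "(\<Sum>a<p * (q * M). if p dvd a then 0 else g a)
      = (\<Sum>a<Q * M. if p dvd a then 0
          else cot (pi * real a / real (Q * M)) * (real Q * cot (pi * real a / real M)))"
    unfolding Qpq[symmetric] mult.assoc[symmetric] by (intro sum.cong refl) (simp add: not_dvd_part)
  \<comment> \<open>Put a = c + m M. As p divides M, both the divisibility of a by p and the factor
    cot (pi a / M) depend on c only.\<close>
  also have "\<dots> = (\<Sum>c<M. \<Sum>m<Q. if p dvd c then 0 else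
      cot (pi * real (c + m * M) / real (Q * M)) * (real Q * cot (pi * real c / real M)))"
    unfolding sum_lessThan_mult cot_shift
    using assms(3) by (subst sum.swap) (simp add: dvd_add_left_iff)
  also have "\<dots> = (\<Sum>c<M. if p dvd c then 0 else (real Q)\<^sup>2 * (cot (pi * real c / real M))\<^sup>2)"
  proof (intro sum.cong refl)
    fix c
    show "(\<Sum>m<Q. if p dvd c then 0 else
        cot (pi * real (c + m * M) / real (Q * M)) * (real Q * cot (pi * real c / real M)))
      = (if p dvd c then 0 else (real Q)\<^sup>2 * (cot (pi * real c / real M))\<^sup>2)"
    proof (cases "p dvd c")
      case False
      then have "\<not> M dvd c"
        using assms(3) dvd_trans by blast
      then have "(\<Sum>m<Q. cot (pi * real (c + m * M) / real (Q * M))) = real Q * cot (pi * real c / real M)"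
        using sum_cot_progression[of Q M 1 c] Q assms(2) by simp
      with False show ?thesis
        by (simp add: power2_eq_square flip: sum_distrib_right)
    qed simp
  qed
  also have "\<dots> = (real Q)\<^sup>2 * (\<Sum>c<M. if p dvd c then 0 else (cot (pi * real c / real M))\<^sup>2)"
    by (simp add: sum_distrib_left if_distrib cong: if_cong)
  finally show ?thesis
    by (simp only: q_def Q_def)
qed

text \<open>Solves the recursion by induction on n, with M = p g. The factor 3 clears the
  denominator of the squared cotangent sum, which is itself the case n = 0.\<close>

lemma cot_sum_prime_power:
  assumes "prime p" "g > 0"
  shows "3 * cot_sum (p ^ n) (p * g) = real p ^ n *
    (real p * (real g)\<^sup>2 * (real p * real p ^ n + real p ^ n - 1) - 3 * real p ^ n * real p * real g + 2)"
proof (induction n)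
  case 0
  have "cot_sum 1 (p * g) = (\<Sum>c<p * g. (cot (pi * real c / real (p * g)))\<^sup>2)"
  proof -
    have "cot (pi * real a * 1 / real (p * g)) = cot (pi * real a / real (p * g))" for a
      by simp
    then show ?thesis
      by (simp add: cot_sum_def power2_eq_square)
  qed
  then show ?case
    using assms prime_gt_0_nat[of p] sum_cot_squared[of "p * g"]
    by (simp add: power2_eq_square algebra_simps)
next
  case (Suc n)
  have p: "p > 0"
    using assms prime_gt_0_nat by blast
  \<comment> \<open>The residues c = p b contribute the complete sum modulo g, so the sum over c
    prime to p is a difference of two known sums.\<close>
  have "(\<Sum>c<p * g. (cot (pi * real c / real (p * g)))\<^sup>2)
      = (\<Sum>c<g. (cot (pi * real c / real g))\<^sup>2)
        + (\<Sum>c<p * g. if p dvd c then 0 else (cot (pi * real c / real (p * g)))\<^sup>2)"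
    using sum_lessThan_mult_split_dvd[OF p, of "\<lambda>c. (cot (pi * real c / real (p * g)))\<^sup>2" g] p
    by simp
  then have D: "3 * (\<Sum>c<p * g. if p dvd c then 0 else (cot (pi * real c / real (p * g)))\<^sup>2)
      = (real p * real g - 1) * (real p * real g - 2) - (real g - 1) * (real g - 2)"
    using sum_cot_squared[of "p * g"] sum_cot_squared[of g] p assms by (simp add: field_simps)
  have "3 * cot_sum (p ^ Suc n) (p * g) = real p * (3 * cot_sum (p ^ n) (p * g))
      + (real p * real p ^ n)\<^sup>2 * (3 * (\<Sum>c<p * g. if p dvd c then 0 else (cot (pi * real c / real (p * g)))\<^sup>2))"
    using cot_sum_prime_power_Suc[of p "p * g" n] assms p by (simp add: algebra_simps)
  then show ?case
    unfolding Suc.IH D by (simp add: power2_eq_square algebra_simps)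
qed

lemma sum_dedekind_sum_eq_cot_sum:
  assumes "q > 0" "M > 0"
  shows "(\<Sum>k = 0..q - 1. dedekind_sum (1 + int k * int M) (q * M)) = cot_sum q M / (4 * real (q * M))"
proof -
  let ?t = "\<lambda>a k. cot (pi * real a / real (q * M)) * cot (pi * real a * (1 + real k * real M) / real (q * M))"
  have "(\<Sum>a<q * M. ?t a k) = (\<Sum>a = 1..q * M - 1. ?t a k)" for k
    using assms by (intro sum.mono_neutral_right) (auto simp: Suc_le_eq)
  moreover have "{0..q - 1} = {..<q}"
    using assms by auto
  ultimately have "(\<Sum>k = 0..q - 1. dedekind_sum (1 + int k * int M) (q * M))
      = (\<Sum>k<q. \<Sum>a<q * M. ?t a k) / (4 * real (q * M))"
    by (simp add: dedekind_sum_def sum_divide_distrib)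
  also have "(\<Sum>k<q. \<Sum>a<q * M. ?t a k) = cot_sum q M"
    unfolding cot_sum_def sum_distrib_left by (rule sum.swap)
  finally show ?thesis .
qed

subsection \<open>Arithmetic of the numerator\<close>

text \<open>For \<open>f' = p g\<close> and \<open>q = p ^ n\<close>, the sum \<open>S(H, f)\<close> is \<open>S_numer p q g / (12 f')\<close>.\<close>

definition S_numer :: "int \<Rightarrow> int \<Rightarrow> int \<Rightarrow> int" where
  "S_numer p q g = p * g\<^sup>2 * (p * q + q - 1) - 3 * q * p * g + 2"

text \<open>Both sides depend only on residues modulo 4, leaving eight cases. They agree because odd
  squares are 1 modulo 4, which makes the numerator congruent to q p g + 3 + (p + 1) (q - 1), and
  the last product is divisible by 4.\<close>

lemma S_numer_mod_4:
  fixes p q g :: int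
  assumes "odd p" "odd q" "odd g"
  shows "S_numer p q g mod 4 = 2 \<longleftrightarrow> (q * (p * g)) mod 4 = 3"
proof -
  have "[x = 1] (mod 4) \<or> [x = 3] (mod 4)" if "odd x" for x :: int
    using that unfolding cong_def by presburger
  then have r: "\<exists>r\<in>{1, 3}. [x = r] (mod 4)" if "odd x" for x :: int
    using that by blast
  obtain a b c where abc: "a \<in> {1, 3}" "b \<in> {1, 3}" "c \<in> {1, 3 :: int}"
    and cong: "[p = a] (mod 4)" "[q = b] (mod 4)" "[g = c] (mod 4)"
    using assms r by meson
  from cong have "[p * g\<^sup>2 * (p * q + q - 1) - 3 * q * p * g + 2
      = a * c\<^sup>2 * (a * b + b - 1) - 3 * b * a * c + 2] (mod 4)"
    by (intro cong_add cong_diff cong_mult cong_pow cong_refl)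
  moreover from cong have "[q * (p * g) = b * (a * c)] (mod 4)"
    by (intro cong_mult)
  ultimately show ?thesis
    using abc by (auto simp: S_numer_def cong_def)
qed

text \<open>Modulo 3 the middle term vanishes and g^2 = 1. If p = 1 then its power q is also 1; if p
  = 2 then p q + q = 3 q drops out. Either way the remaining terms cancel.\<close>

lemma three_dvd_S_numer:
  fixes p g :: int
  assumes "\<not> 3 dvd p" "\<not> 3 dvd g"
  shows "3 dvd S_numer p (p ^ n) g"
proof -
  define q where "q = p ^ n"
  have r: "[x = 1] (mod 3) \<or> [x = 2] (mod 3)" if "\<not> 3 dvd x" for x :: int
    using that unfolding cong_def by presburger
  obtain a where a: "a = 1 \<or> a = 2" "[g = a] (mod 3)"
    using r[OF assms(2)] by blast
  have "[p * g\<^sup>2 * (p * q + q - 1) - 3 * q * p * g + 2 = 0] (mod 3)"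
    using r[OF assms(1)]
  proof
    assume p: "[p = 1] (mod 3)"
    then have "[q = 1] (mod 3)"
      using cong_pow[OF p, of n] by (simp add: q_def)
    with p a have "[p * g\<^sup>2 * (p * q + q - 1) - 3 * q * p * g + 2
        = 1 * a\<^sup>2 * (1 * 1 + 1 - 1) - 3 * 1 * 1 * a + 2] (mod 3)"
      by (intro cong_add cong_diff cong_mult cong_pow cong_refl)
    then show ?thesis
      using a(1) by (auto simp: cong_def)
  next
    assume p: "[p = 2] (mod 3)"
    with a have "[p * g\<^sup>2 * (p * q + q - 1) - 3 * q * p * g + 2
        = 2 * a\<^sup>2 * (2 * q + q - 1) - 3 * q * 2 * a + 2] (mod 3)"
      by (intro cong_add cong_diff cong_mult cong_pow cong_refl)
    also have "2 * a\<^sup>2 * (2 * q + q - 1) - 3 * q * 2 * a + 2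
        = 3 * (2 * a\<^sup>2 * q - 2 * q * a) + (2 - 2 * a\<^sup>2)"
      by (simp add: algebra_simps)
    also have "[\<dots> = 0] (mod 3)"
      using a(1) by (auto simp: cong_0_iff)
    finally show ?thesis .
  qed
  then show ?thesis
    by (simp add: S_numer_def q_def cong_0_iff)
qed

text \<open>Gives integrality, since 2 gcd(3,f) (f/q) S equals gcd(3,f) \<open>S_numer\<close> / 6.
  The factor 3 comes from the gcd when 3 divides f, and from the numerator otherwise.\<close>

lemma six_dvd_gcd_mult_S_numer:
  fixes p g q :: int
  assumes "odd p" "odd g" and q: "q = p ^ n" and "n > 0"
  shows "6 dvd gcd 3 (q * (p * g)) * S_numer p q g"
    (is "6 dvd gcd 3 ?f * ?B")
proof -
  have "2 dvd ?B"
    using assms by (simp add: S_numer_def)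
  moreover have "3 dvd gcd 3 ?f * ?B"
  proof (cases "3 dvd ?f")
    case False
    then have "\<not> 3 dvd p" "\<not> 3 dvd g"
      by auto
    then show ?thesis
      using three_dvd_S_numer[of p g n] by (simp add: q)
  qed (simp add: gcd_proj1_if_dvd)
  moreover have "6 dvd z" if "2 dvd z" "3 dvd z" for z :: int
    using that by presburger
  ultimately show ?thesis
    by simp
qed

lemma S_numer_quotient:
  fixes p g q m :: int
  assumes p: "odd p" "p > 1" and g: "odd g" and q: "q = p ^ n" and "n > 0"
    and m: "6 * m = gcd 3 (q * (p * g)) * S_numer p q g"
  shows "\<not> p dvd m" "odd m \<longleftrightarrow> (q * (p * g)) mod 4 = 3"
proof -
  let ?f = "q * (p * g)" and ?B = "S_numer p q g"
  have "gcd 3 ?f dvd 3"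
    by simp
  then have "gcd 3 ?f = 1 \<or> gcd 3 ?f = 3"
    using prime_int_iff[of 3] by simp
  \<comment> \<open>Here c = 6 / gcd(3,f).\<close>
  then obtain c where c: "c \<in> {2, 6}" "c * m = ?B"
    using m by fastforce
  show "\<not> p dvd m"
  proof
    assume "p dvd m"
    then have "p dvd ?B"
      by (simp flip: c(2))
    \<comment> \<open>The numerator is 2 modulo p, and p is odd.\<close>
    moreover have "?B = p * (g\<^sup>2 * (p * q + q - 1) - 3 * q * g) + 2"
      by (simp add: S_numer_def algebra_simps)
    ultimately have "p dvd 2"
      by (simp add: dvd_add_right_iff)
    then have "p \<le> 2"
      by (simp add: zdvd_imp_le)
    then show False
      using p by presburger
  qed
  \<comment> \<open>Both values of c are twice an odd number.\<close>
  have "odd m \<longleftrightarrow> ?B mod 4 = 2"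
    unfolding c(2)[symmetric] using c(1) by auto presburger+
  also have "\<dots> \<longleftrightarrow> ?f mod 4 = 3"
    using p g q by (intro S_numer_mod_4) auto
  finally show "odd m \<longleftrightarrow> ?f mod 4 = 3" .
qed

subsection \<open>The kernel of reduction\<close>

lemma coprime_one_add_mult: "coprime (1 + k * m) (m :: int)"
  by (rule coprimeI) (metis dvd_add_left_iff dvd_mult)

lemma carrier_mult_group_mod:
  "m > 1 \<Longrightarrow> carrier (mult_group_mod m) = {x. 0 < x \<and> x < int m \<and> coprime x (int m)}"
  by (simp add: mult_group_mod_def units_of_carrier residues.res_units_eq residues_def)

lemma mult_mult_group_mod: "x \<otimes>\<^bsub>mult_group_mod m\<^esub> y = (x * y) mod int m"
  by (simp add: mult_group_mod_def units_of_mult residue_ring_def)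

lemma one_mult_group_mod: "\<one>\<^bsub>mult_group_mod m\<^esub> = 1"
  by (simp add: mult_group_mod_def units_of_one residue_ring_def)

lemma group_mult_group_mod:
  assumes "m > 1"
  shows "group (mult_group_mod m)"
proof -
  interpret residues "int m" "residue_ring (int m)"
    using assms by unfold_locales auto
  show ?thesis
    unfolding mult_group_mod_def by (rule units_group)
qed

lemma one_less_mult: "q > 0 \<Longrightarrow> M > 1 \<Longrightarrow> q * M > (1 :: nat)"
  using mult_le_mono1[of 1 q M] by linarith

lemma H_ker_eq_image: "H_ker q M = (\<lambda>k. 1 + int k * int M) ` {0..q - 1}"
  by (auto simp: H_ker_def)

lemma inj_on_progression: "M > 0 \<Longrightarrow> inj_on (\<lambda>k. 1 + int k * int M) A"
  by (intro inj_onI) simp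

context
  fixes q M :: nat
  assumes q: "q > 0" and M: "M > 1"
    and coprime_lift: "\<And>x. coprime x (int M) \<Longrightarrow> coprime x (int q)"
begin

text \<open>Surjectivity uses \<open>coprime_lift\<close>: a least residue prime to M is already
  prime to q M, so it is its own preimage.\<close>

lemma mod_in_epi: "(\<lambda>x. x mod int M) \<in> epi (mult_group_mod (q * M)) (mult_group_mod M)"
proof -
  have cop: "coprime (x mod int M) (int M)" if "coprime x (int M)" for x
    using that M by simp
  have "x mod int M \<in> carrier (mult_group_mod M)" if "x \<in> carrier (mult_group_mod (q * M))" for x
  proof -
    have "coprime x (int M)"
      using that one_less_mult[OF q M] by (simp add: carrier_mult_group_mod)
    with cop have c: "coprime (x mod int M) (int M)"
      by blast
    then have "x mod int M \<noteq> 0"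
      using M by auto
    moreover have "x mod int M \<ge> 0"
      using M by simp
    ultimately have "x mod int M > 0"
      by linarith
    then show ?thesis
      using c M by (simp add: carrier_mult_group_mod)
  qed
  moreover have "x \<in> (\<lambda>x. x mod int M) ` carrier (mult_group_mod (q * M))"
    if "x \<in> carrier (mult_group_mod M)" for x
  proof
    have x: "0 < x" "x < int M" "coprime x (int M)"
      using that M by (auto simp: carrier_mult_group_mod)
    then show "x = x mod int M"
      by simp
    have "int M \<le> int q * int M"
      using q M by simp
    with x(2) have "x < int q * int M"
      by linarith
    then show "x \<in> carrier (mult_group_mod (q * M))"
      using x one_less_mult[OF q M] coprime_lift by (auto simp: carrier_mult_group_mod)
  qed
  ultimately show ?thesis
    by (auto simp: epi_def hom_def mult_mult_group_mod mod_mult_eq mod_mod_cancel)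
qed

lemma H_ker_eq_kernel:
  "H_ker q M = kernel (mult_group_mod (q * M)) (mult_group_mod M) (\<lambda>x. x mod int M)"
proof (intro equalityI subsetI)
  fix x assume "x \<in> H_ker q M"
  then obtain k where k: "k \<le> q - 1" "x = 1 + int k * int M"
    by (auto simp: H_ker_def)
  \<comment> \<open>Since M > 1, this keeps 1 + k M strictly below q M, so it is its own least
    residue.\<close>
  have "k * M + M \<le> q * M"
    using k q by (metis Suc_pred' add.commute le_imp_less_Suc mult_Suc mult_le_mono1 Suc_leI)
  then have "int k * int M + int M \<le> int (q * M)"
    by (metis of_nat_add of_nat_le_iff of_nat_mult)
  moreover have "coprime (1 + int k * int M) (int M)"
    by (rule coprime_one_add_mult)
  moreover have "x mod int M = 1"
    using M k by simp
  ultimately show "x \<in> kernel (mult_group_mod (q * M)) (mult_group_mod M) (\<lambda>x. x mod int M)"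
    using M k one_less_mult[OF q M] coprime_lift
    by (auto simp: kernel_def carrier_mult_group_mod one_mult_group_mod add_pos_nonneg)
next
  fix x assume "x \<in> kernel (mult_group_mod (q * M)) (mult_group_mod M) (\<lambda>x. x mod int M)"
  then have x: "0 < x" "x < int q * int M" "x mod int M = 1"
    using one_less_mult[OF q M] by (auto simp: kernel_def carrier_mult_group_mod one_mult_group_mod)
  define k where "k = nat (x div int M)"
  have "0 \<le> x div int M"
    using x M by (simp add: pos_imp_zdiv_nonneg_iff)
  moreover have "x div int M < int q"
  proof -
    have "x div int M * int M < int q * int M"
      using x div_mult_mod_eq[of x "int M"] by linarith
    then show ?thesis
      using M by simp
  qed
  ultimately have "k \<le> q - 1" "x = 1 + int k * int M"
    using x(3) div_mult_mod_eq[of x "int M"] by (auto simp: k_def)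
  then show "x \<in> H_ker q M"
    by (auto simp: H_ker_def)
qed

end

section \<open>The sum T and its greatest common divisor with f\<close>

lemma two_T_sum: "q > 0 \<Longrightarrow> 2 * T_sum q M = 2 * int q + (int q - 1) * (int q * int M)"
proof (induction q rule: nat_induct_non_zero)
  case (Suc q)
  have "{0..Suc q - 1} = insert q {0..q - 1}"
    using Suc.hyps by auto
  then have "T_sum (Suc q) M = T_sum q M + (1 + int q * int M)"
    using Suc.hyps by (simp add: T_sum_def)
  then show ?case
    using Suc.IH by (simp add: algebra_simps)
qed (simp add: T_sum_def)

text \<open>With q = 2 r + 1 the sum factors as q (1 + r M), and 1 + r M is prime to M.\<close>

lemma gcd_T_sum:
  assumes "odd q"
  shows "gcd (int (q * M)) (T_sum q M) = int q"
proof -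
  obtain r where r: "q = 2 * r + 1"
    using assms oddE by blast
  have "2 * T_sum q M = 2 * (int q * (1 + int r * int M))"
    using two_T_sum[of q M] r by (simp add: algebra_simps)
  then have "T_sum q M = int q * (1 + int r * int M)"
    by simp
  moreover have "gcd (int M) (1 + int r * int M) = 1"
    using coprime_one_add_mult[of "int r" "int M"] by (simp add: coprime_iff_gcd_eq_1 gcd.commute)
  ultimately show ?thesis
    by (simp flip: gcd_mult_distrib_int)
qed

theorem theorem5p3:
  fixes p n f f' :: nat
  assumes "prime p" and "p \<ge> 3"
    and "f' > 1" and "odd f'" and "p dvd f'"
    and "n \<ge> 1"
    and "f = p ^ n * f'"
  shows
    "(\<lambda>x. x mod int f') \<in> epi (mult_group_mod f) (mult_group_mod f') \<and>
     H_ker (p ^ n) f' = kernel (mult_group_mod f) (mult_group_mod f') (\<lambda>x. x mod int f') \<and>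
     subgroup (H_ker (p ^ n) f') (mult_group_mod f) \<and>
     card (H_ker (p ^ n) f') = p ^ n \<and>
     real_of_int (T_sum (p ^ n) f') = real p ^ n + (real p ^ n - 1) / 2 * real f \<and>
     gcd (int f) (T_sum (p ^ n) f') = int p ^ n \<and>
     S_sum (H_ker (p ^ n) f') f = (\<Sum>k = 0..p ^ n - 1. dedekind_sum (1 + int k * int f') f) \<and>
     S_sum (H_ker (p ^ n) f') f =
       (real p ^ (n + 1) + real p ^ n - 1) / (12 * real p ^ (n + 1)) * real f
         - real p ^ n / 4 + real p ^ n / (6 * real f) \<and>
     (\<exists>m :: int.
        2 * real (gcd 3 f) * (real f / real p ^ n) * S_sum (H_ker (p ^ n) f') f = of_int m \<and>
        \<not> int p dvd m \<and>
        (odd m \<longleftrightarrow> [f = 3] (mod 4)))"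
proof -
  define q where "q = p ^ n"
  have f: "f = q * f'"
    using assms(7) by (simp add: q_def)
  obtain g where g: "f' = p * g"
    using assms(5) by (elim dvdE)
  have p: "odd p" and og: "odd g"
    using assms(4) g by auto
  have q: "q > 0" "odd q"
    using assms(2) p by (auto simp: q_def)
  have g0: "g > 0"
    using og by (auto intro: gr0I)
  \<comment> \<open>The only prime factor of q is p, which divides f'.\<close>
  have lift: "coprime x (int q)" if "coprime x (int f')" for x
    using that by (simp add: g q_def)
  note H = mod_in_epi[OF q(1) assms(3) lift] H_ker_eq_kernel[OF q(1) assms(3) lift]
  have sub: "subgroup (H_ker q f') (mult_group_mod f)"
  proof -
    interpret group_hom "mult_group_mod f" "mult_group_mod f'" "\<lambda>x. x mod int f'"
      using H(1) group_mult_group_mod one_less_mult[OF q(1) assms(3)] assms(3)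
      by (simp add: group_hom_def group_hom_axioms_def epi_def f)
    show ?thesis
      using subgroup_kernel by (simp add: H(2) f)
  qed
  have card: "card (H_ker q f') = q"
    unfolding H_ker_eq_image using q(1)
    by (subst card_image) (use assms(3) in \<open>auto intro: inj_on_progression\<close>)
  have "2 * real_of_int (T_sum q f') = 2 * real q + (real q - 1) * real f"
    using arg_cong[OF two_T_sum[OF q(1), of f'], of real_of_int] by (simp add: f)
  then have T: "real_of_int (T_sum q f') = real q + (real q - 1) / 2 * real f"
    by simp
  have S: "S_sum (H_ker q f') f = (\<Sum>k = 0..q - 1. dedekind_sum (1 + int k * int f') f)"
    unfolding S_sum_def H_ker_eq_image using assms(3)
    by (simp add: sum.reindex inj_on_progression)
  define B where "B = S_numer (int p) (int q) (int g)"
  have "S_sum (H_ker q f') f = cot_sum q f' / (4 * real f)"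
    using sum_dedekind_sum_eq_cot_sum[OF q(1), of f'] assms(3) unfolding S by (simp add: f)
  \<comment> \<open>The bracket in the closed form of \<open>cot_sum\<close> is exactly
    \<open>S_numer\<close>; its factor q cancels against f = q f' in the next step.\<close>
  moreover have "cot_sum q f' = real q * of_int B / 3"
    using cot_sum_prime_power[OF assms(1) g0, of n] by (simp add: B_def S_numer_def q_def g)
  ultimately have SB: "S_sum (H_ker q f') f = real_of_int B / (12 * real f')"
    using q(1) by (simp add: f)
  have formula: "S_sum (H_ker q f') f = (real p * real q + real q - 1) / (12 * (real p * real q)) * real f
      - real q / 4 + real q / (6 * real f)"
    unfolding SB unfolding B_def S_numer_def f g using q(1) g0 assms(2) by (simp add: field_simps power2_eq_square)
  obtain m where m: "gcd 3 (int q * (int p * int g)) * B = 6 * m"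
    using six_dvd_gcd_mult_S_numer[of "int p" "int g" "int q" n] p og assms(6)
    by (auto simp: B_def q_def elim: dvdE)
  have gcd: "gcd 3 (int q * (int p * int g)) = int (gcd 3 f)"
    using gcd_int_int_eq[of 3 f] by (simp add: f g)
  have "6 * real_of_int m = real (gcd 3 f) * of_int B"
    using arg_cong[OF m, of real_of_int] gcd by simp
  \<comment> \<open>As f / q = f' cancels the denominator 12 f' up to 12, what remains is gcd(3,f) B
    / 6 = m.\<close>
  then have "2 * real (gcd 3 f) * (real f / real q) * S_sum (H_ker q f') f = of_int m"
    unfolding SB unfolding f using q(1) assms(3) by (simp add: field_simps)
  moreover have "\<not> int p dvd m" "odd m \<longleftrightarrow> (int q * (int p * int g)) mod 4 = 3"
    using S_numer_quotient[of "int p" "int g" "int q" n m] p og assms(2,6) m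
    by (simp_all add: B_def q_def)
  moreover have "(int q * (int p * int g)) mod 4 = 3 \<longleftrightarrow> [f = 3] (mod 4)"
    using cong_int_iff[of f 3 4] by (simp add: cong_def f g)
  ultimately have "\<exists>m :: int. 2 * real (gcd 3 f) * (real f / real q) * S_sum (H_ker q f') f = of_int m \<and>
      \<not> int p dvd m \<and> (odd m \<longleftrightarrow> [f = 3] (mod 4))"
    by blast
  then show ?thesis
    using H sub card T gcd_T_sum[OF q(2), of f'] S formula by (simp add: q_def f)
qed

end
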